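(* Suppose $\mathcal{U}$ is a block-basic ultrafilter on $\mathrm{FIN}$ and $\mathcal{V}$ is any ultrafilter on a countable set $I$. If $\mathcal{U}_{\min,\max}\ge_T\mathcal{V}$, then there are an infinite block sequence $\tilde{X}$ with $[\tilde{X}]\in\mathcal{U}$ and a monotone continuous function $f$ from $\{[X]_{\min,\max}:X\le\tilde{X}\}$ into $\mathcal{P}(I)$ whose restriction to $\{[X]_{\min,\max}:X\le\tilde{X},\ [X]\in\mathcal{U}\}$ has range contained in and cofinal in $(\mathcal{V},\supseteq)$.
   Context: $\mathrm{FIN}$ is the set of nonempty finite subsets of $\omega$. A block sequence is $X=(x_n)$ in $\mathrm{FIN}$ with $\max x_n<\min x_{n+1}$; $[X]$ is the set of finite unions of its members; $Y\le X$ iff every member of $Y$ is in $[X]$. An ultrafilter on $\mathrm{FIN}$ is block-generated if generated by sets $[X]$, $X$ an infinite block sequence. Infinite block sequences $X_n=(x^n_k)$ converge to $X=(x_k)$ if for each $l$ there is $m$ with $x^n_k=x_k$ for all $n\ge m$, $k\le l$; a block-generated $\mathcal{U}$ is block-basic if whenever $[X_n]\in\mathcal{U}$ and $X_n\to X$ with $[X]\in\mathcal{U}$, some subsequence has $\bigcap_k[X_{n_k}]\in\mathcal{U}$. For $A\subseteq\mathrm{FIN}$, $A_{\min,\max}=\{(\min x,\max x):x\in A\}\subseteq\omega\times\omega$, and $\mathcal{U}_{\min,\max}$ is the ultrafilter on $\omega\times\omega$ generated by $\{U_{\min,\max}:U\in\mathcal{U}\}$. $\mathcal{W}\ge_T\mathcal{V}$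 means there is a map $\mathcal{W}\to\mathcal{V}$ sending cofinal subsets of $(\mathcal{W},\supseteq)$ to cofinal subsets of $(\mathcal{V},\supseteq)$. Monotone means $A\subseteq B\Rightarrow f(A)\subseteq f(B)$; continuity refers to the Cantor topologies on $\mathcal{P}(\omega\times\omega)$ and $\mathcal{P}(I)$. *)

theory Defs
  imports "HOL-Analysis.Analysis"
begin

definition FIN :: "nat set set" where
  "FIN = {x. finite x \<and> x \<noteq> {}}"

text \<open>Infinite block sequences only; finite ones are not represented.\<close>

definition block_seq :: "(nat \<Rightarrow> nat set) \<Rightarrow> bool" where
  "block_seq X \<longleftrightarrow> (\<forall>n. X n \<in> FIN) \<and> (\<forall>n. Max (X n) < Min (X (Suc n)))"

definition block_span :: "(nat \<Rightarrow> nat set) \<Rightarrow> nat set set" where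
  "block_span X = {\<Union>n\<in>F. X n | F. finite F \<and> F \<noteq> {}}"

definition block_le :: "(nat \<Rightarrow> nat set) \<Rightarrow> (nat \<Rightarrow> nat set) \<Rightarrow> bool" where
  "block_le Y X \<longleftrightarrow> range Y \<subseteq> block_span X"

text \<open>Principal ultrafilters are included.\<close>

definition ultrafilter_on :: "'a set \<Rightarrow> 'a set set \<Rightarrow> bool" where
  "ultrafilter_on S U \<longleftrightarrow>
     U \<subseteq> Pow S \<and> S \<in> U \<and> {} \<notin> U \<and>
     (\<forall>A\<in>U. \<forall>B\<in>U. A \<inter> B \<in> U) \<and>
     (\<forall>A\<in>U. \<forall>B\<subseteq>S. A \<subseteq> B \<longrightarrow> B \<in> U) \<and>
     (\<forall>A\<subseteq>S. A \<in> U \<or> S - A \<in> U)"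

text \<open>``Generated'' means that the sets \<open>block_span X\<close> in \<open>U\<close> form a filter base of \<open>U\<close>.\<close>

definition block_generated :: "nat set set set \<Rightarrow> bool" where
  "block_generated U \<longleftrightarrow> ultrafilter_on FIN U \<and>
     (\<forall>A\<in>U. \<exists>X. block_seq X \<and> block_span X \<in> U \<and> block_span X \<subseteq> A)"

definition block_converges :: "(nat \<Rightarrow> nat \<Rightarrow> nat set) \<Rightarrow> (nat \<Rightarrow> nat set) \<Rightarrow> bool" where
  "block_converges Xs X \<longleftrightarrow> (\<forall>l. \<exists>m. \<forall>n\<ge>m. \<forall>k\<le>l. Xs n k = X k)"

definition block_basic :: "nat set set set \<Rightarrow> bool" where
  "block_basic U \<longleftrightarrow> block_generated U \<and>
     (\<forall>Xs X. (\<forall>n. block_seq (Xs n) \<and> block_span (Xs n) \<in> U) \<longrightarrow>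
        block_seq X \<longrightarrow> block_span X \<in> U \<longrightarrow> block_converges Xs X \<longrightarrow>
        (\<exists>r. strict_mono (r :: nat \<Rightarrow> nat) \<and> (\<Inter>k. block_span (Xs (r k))) \<in> U))"

definition minmax :: "nat set set \<Rightarrow> (nat \<times> nat) set" where
  "minmax A = (\<lambda>x. (Min x, Max x)) ` A"

definition minmax_ultrafilter :: "nat set set set \<Rightarrow> (nat \<times> nat) set set" where
  "minmax_ultrafilter U = {B. \<exists>A\<in>U. minmax A \<subseteq> B}"

lemma ultrafilter_on_minmax_ultrafilter:
  assumes "ultrafilter_on FIN U"
  shows "ultrafilter_on UNIV (minmax_ultrafilter U)"
proof -
  have inter: "A \<inter> B \<in> U" if "A \<in> U" "B \<in> U" for A B
    using assms that by (simp add: ultrafilter_on_def)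
  have dichotomy: "A \<in> U \<or> FIN - A \<in> U" if "A \<subseteq> FIN" for A
    using assms that by (simp add: ultrafilter_on_def)
  have "{} \<notin> U" "FIN \<in> U"
    using assms by (simp_all add: ultrafilter_on_def)
  then have nontriv: "{} \<notin> minmax_ultrafilter U" "UNIV \<in> minmax_ultrafilter U"
    by (auto simp: minmax_ultrafilter_def minmax_def)
  have "B \<in> minmax_ultrafilter U \<or> - B \<in> minmax_ultrafilter U" for B
  proof -
    let ?A = "{x \<in> FIN. (Min x, Max x) \<in> B}"
    have "?A \<in> U \<or> FIN - ?A \<in> U"
      by (rule dichotomy) blast
    moreover have "minmax ?A \<subseteq> B" "minmax (FIN - ?A) \<subseteq> - B"
      by (auto simp: minmax_def)
    ultimately show ?thesis
      unfolding minmax_ultrafilter_def by blast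
  qed
  moreover have "B \<inter> C \<in> minmax_ultrafilter U"
    if BC: "B \<in> minmax_ultrafilter U" "C \<in> minmax_ultrafilter U" for B C
  proof -
    obtain A A' where "A \<in> U" "minmax A \<subseteq> B" "A' \<in> U" "minmax A' \<subseteq> C"
      using BC by (auto simp: minmax_ultrafilter_def)
    then have "A \<inter> A' \<in> U" "minmax (A \<inter> A') \<subseteq> B \<inter> C"
      using inter by (auto simp: minmax_def)
    then show ?thesis
      unfolding minmax_ultrafilter_def by blast
  qed
  moreover have "C \<in> minmax_ultrafilter U"
    if "B \<in> minmax_ultrafilter U" "B \<subseteq> C" for B C
    using that unfolding minmax_ultrafilter_def by (blast intro: subset_trans)
  ultimately show ?thesis
    using nontriv by (simp add: ultrafilter_on_def Compl_eq_Diff_UNIV)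
qed

text \<open>Cofinality with respect to reverse inclusion.\<close>

definition cofinal_in :: "'a set set \<Rightarrow> 'a set set \<Rightarrow> bool" where
  "cofinal_in V C \<longleftrightarrow> C \<subseteq> V \<and> (\<forall>A\<in>V. \<exists>B\<in>C. B \<subseteq> A)"

definition tukey_ge :: "'a set set \<Rightarrow> 'b set set \<Rightarrow> bool" where
  "tukey_ge W V \<longleftrightarrow>
     (\<exists>g. g ` W \<subseteq> V \<and> (\<forall>C. cofinal_in W C \<longrightarrow> cofinal_in V (g ` C)))"

text \<open>The topology on the power set of \<open>S\<close> obtained by identifying subsets of \<open>S\<close>
  with their characteristic functions, i.e. with points of the product of
  \<open>S\<close> many copies of the discrete two-point space.\<close>

definition cantor_topology :: "'a set \<Rightarrow> 'a set topology" where
  "cantor_topology S =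
     pullback_topology (Pow S) (\<lambda>A. \<lambda>i\<in>S. i \<in> A)
       (product_topology (\<lambda>_. discrete_topology (UNIV :: bool set)) S)"

lemma topspace_cantor_topology [simp]: "topspace (cantor_topology S) = Pow S"
  by (auto simp: cantor_topology_def topspace_pullback_topology)

end

theory Submission
  imports Defs
begin

text \<open>A Tukey reduction may be replaced by a monotone map \<open>h\<close>. For \<open>A = minmax (block_span W)\<close>
  and a bound \<open>N\<close>, consider the part of \<open>A\<close> in the square below \<open>N\<close>
  together with the first coordinates below \<open>N\<close>. There are finitely many such traces \<open>(Q, P)\<close>, and
  \<open>i \<notin> h A\<close> implies that the trace of \<open>A\<close> has some prolongation by a set of \<open>U\<close> whose image
  under \<open>h\<close> omits \<open>i\<close>. Hence a single \<open>block_span Y\<close> in \<open>U\<close> realises all possible omissions for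
  finitely many \<open>i\<close> and all traces below \<open>N\<close>. Putting such \<open>Y\<^sub>n\<close> after the first \<open>n + 1\<close>
  blocks of a fixed \<open>X\<close> gives sequences converging to \<open>X\<close>; block-basicness yields one sequence below infinitely
  many of them, and below it membership of \<open>i\<close> in \<open>h A\<close> depends on a trace of \<open>A\<close> only.\<close>

section \<open>Block sequences\<close>

lemma FIN_block: "block_seq X \<Longrightarrow> X n \<in> FIN"
  by (simp add: block_seq_def)

lemma Min_le_Max_FIN: "x \<in> FIN \<Longrightarrow> Min x \<le> Max x"
  by (simp add: FIN_def)

lemma block_seq_Max_less_Min:
  assumes "block_seq X" "m < n"
  shows "Max (X m) < Min (X n)"
  using \<open>m < n\<close>
proof (induction n)
  case (Suc n)
  have step: "Max (X n) < Min (X (Suc n))"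
    using assms by (simp add: block_seq_def)
  show ?case
  proof (cases "m = n")
    case False
    then have "Max (X m) < Min (X n)"
      using Suc by simp
    also have "\<dots> \<le> Max (X n)"
      using assms by (intro Min_le_Max_FIN FIN_block)
    finally show ?thesis
      using step by simp
  qed (use step in simp)
qed simp

lemma block_seq_Min_mono:
  assumes "block_seq X" "m \<le> n"
  shows "Min (X m) \<le> Min (X n)"
  using block_seq_Max_less_Min[OF assms(1), of m n] Min_le_Max_FIN[OF FIN_block[OF assms(1)], of m] assms(2)
  by (cases "m = n") auto

lemma block_seq_Max_mono:
  assumes "block_seq X" "m \<le> n"
  shows "Max (X m) \<le> Max (X n)"
  using block_seq_Max_less_Min[OF assms(1), of m n] Min_le_Max_FIN[OF FIN_block[OF assms(1)], of n] assms(2)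
  by (cases "m = n") auto

lemma block_seq_le_Min: "block_seq X \<Longrightarrow> n \<le> Min (X n)"
proof (induction n)
  case (Suc n)
  then show ?case
    using block_seq_Max_less_Min[of X n "Suc n"] Min_le_Max_FIN[OF FIN_block, of X n] by simp
qed simp

lemma block_in_block_span: "X n \<in> block_span X"
  unfolding block_span_def by (rule CollectI, rule exI[of _ "{n}"]) simp

lemma block_span_subset_FIN:
  assumes "block_seq X"
  shows "block_span X \<subseteq> FIN"
proof
  fix x
  assume "x \<in> block_span X"
  then obtain F where "x = (\<Union>n\<in>F. X n)" "finite F" "F \<noteq> {}"
    by (auto simp: block_span_def)
  moreover have "finite (X n) \<and> X n \<noteq> {}" for n
    using FIN_block[OF assms, of n] by (simp add: FIN_def)
  ultimately show "x \<in> FIN"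
    by (auto simp: FIN_def)
qed

lemma block_span_shift: "block_span (\<lambda>n. X (n + k)) \<subseteq> block_span X"
proof
  fix x
  assume "x \<in> block_span (\<lambda>n. X (n + k))"
  then obtain F where "x = (\<Union>n\<in>F. X (n + k))" "finite F" "F \<noteq> {}"
    by (auto simp: block_span_def)
  then have "x = (\<Union>n\<in>(\<lambda>n. n + k) ` F. X n)" "finite ((\<lambda>n. n + k) ` F)" "(\<lambda>n. n + k) ` F \<noteq> {}"
    by auto
  then show "x \<in> block_span X"
    unfolding block_span_def by blast
qed

lemma block_span_mono:
  assumes "block_le Y X"
  shows "block_span Y \<subseteq> block_span X"
proof
  fix y
  assume "y \<in> block_span Y"
  then obtain F where y: "y = (\<Union>n\<in>F. Y n)" and F: "finite F" "F \<noteq> {}"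
    by (auto simp: block_span_def)
  have "\<forall>n. \<exists>G. Y n = (\<Union>j\<in>G. X j) \<and> finite G \<and> G \<noteq> {}"
    using assms unfolding block_le_def block_span_def by blast
  then obtain G where G: "\<And>n. Y n = (\<Union>j\<in>G n. X j) \<and> finite (G n) \<and> G n \<noteq> {}"
    by metis
  have "y = (\<Union>j\<in>(\<Union>n\<in>F. G n). X j)"
    using G by (auto simp: y)
  moreover have "finite (\<Union>n\<in>F. G n)" "(\<Union>n\<in>F. G n) \<noteq> {}"
    using F G by auto
  ultimately show "y \<in> block_span X"
    unfolding block_span_def by blast
qed

lemma block_le_if_span_subset: "block_span Y \<subseteq> block_span X \<Longrightarrow> block_le Y X"
  using block_in_block_span[of Y] by (auto simp: block_le_def)

section \<open>Minima and maxima\<close>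

lemma minmax_mono: "A \<subseteq> B \<Longrightarrow> minmax A \<subseteq> minmax B"
  by (auto simp: minmax_def)

text \<open>The blocks are ordered, so the minimum of a finite union comes from its least index and
  the maximum from its greatest; the blocks in between leave no mark. Any \<open>p \<le> q\<close>
  arises from \<open>X p \<union> X q\<close>.\<close>

lemma minmax_block_span:
  assumes X: "block_seq X"
  shows "minmax (block_span X) = {(Min (X p), Max (X q)) | p q. p \<le> q}"
proof (intro equalityI subsetI)
  fix c
  assume "c \<in> minmax (block_span X)"
  then obtain F where F: "finite F" "F \<noteq> {}" and c: "c = (Min (\<Union>n\<in>F. X n), Max (\<Union>n\<in>F. X n))"
    by (auto simp: minmax_def block_span_def)
  have fin: "finite (X n)" "X n \<noteq> {}" for n
    using FIN_block[OF X, of n] by (auto simp: FIN_def)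
  have "Min (\<Union>n\<in>F. X n) = Min (X (Min F))"
  proof (rule Min_eqI)
    fix y
    assume "y \<in> (\<Union>n\<in>F. X n)"
    then obtain n where "n \<in> F" "y \<in> X n"
      by blast
    then show "Min (X (Min F)) \<le> y"
      using block_seq_Min_mono[OF X, of "Min F" n] F fin by (auto intro: order_trans)
  next
    show "Min (X (Min F)) \<in> (\<Union>n\<in>F. X n)"
      using Min_in[OF F] Min_in[OF fin, of "Min F"] by blast
  qed (use F(1) fin(1) in simp)
  moreover have "Max (\<Union>n\<in>F. X n) = Max (X (Max F))"
  proof (rule Max_eqI)
    fix y
    assume "y \<in> (\<Union>n\<in>F. X n)"
    then obtain n where "n \<in> F" "y \<in> X n"
      by blast
    then show "y \<le> Max (X (Max F))"
      using block_seq_Max_mono[OF X, of n "Max F"] F fin by (auto intro: order_trans)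
  next
    show "Max (X (Max F)) \<in> (\<Union>n\<in>F. X n)"
      using Max_in[OF F] Max_in[OF fin, of "Max F"] by blast
  qed (use F(1) fin(1) in simp)
  moreover have "Min F \<le> Max F"
    using F by simp
  ultimately show "c \<in> {(Min (X p), Max (X q)) | p q. p \<le> q}"
    using c by blast
next
  fix c
  assume "c \<in> {(Min (X p), Max (X q)) | p q. p \<le> q}"
  then obtain p q where pq: "p \<le> q" and c: "c = (Min (X p), Max (X q))"
    by blast
  have fin: "finite (X n)" "X n \<noteq> {}" for n
    using FIN_block[OF X, of n] by (auto simp: FIN_def)
  have "Min (X p \<union> X q) = Min (X p)" "Max (X p \<union> X q) = Max (X q)"
    using block_seq_Min_mono[OF X pq] block_seq_Max_mono[OF X pq] fin
    by (simp_all add: Min_Un Max_Un min_def max_def)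
  moreover have "X p \<union> X q \<in> block_span X"
    unfolding block_span_def by (rule CollectI, rule exI[of _ "{p, q}"]) simp
  ultimately show "c \<in> minmax (block_span X)"
    unfolding minmax_def c by (intro image_eqI[of _ _ "X p \<union> X q"]) simp_all
qed

text \<open>If \<open>m\<close> comes from block \<open>p\<close> and \<open>M'\<close> from block
  \<open>q\<close>, then \<open>q < p\<close> would put \<open>M'\<close> below \<open>m\<close>.
  This lets a low minimum be paired with any later maximum.\<close>

lemma minmax_block_span_exchange:
  assumes X: "block_seq X"
    and "(m, M) \<in> minmax (block_span X)" "(m', M') \<in> minmax (block_span X)" "m \<le> M'"
  shows "(m, M') \<in> minmax (block_span X)"
proof -
  obtain p q where m: "m = Min (X p)" and M': "M' = Max (X q)"
    using assms(2,3) by (auto simp: minmax_block_span[OF X])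
  have "p \<le> q"
    using block_seq_Max_less_Min[OF X, of q p] \<open>m \<le> M'\<close> m M' by force
  then show ?thesis
    using m M' by (auto simp: minmax_block_span[OF X])
qed

section \<open>Block-generated ultrafilters\<close>

text \<open>Otherwise the complement would contain some \<open>block_span X\<close>, but
  \<open>X N\<close> already starts at \<open>N\<close> or later.\<close>

lemma ultrafilter_on_tail:
  assumes "block_generated U"
  shows "{x \<in> FIN. N \<le> Min x} \<in> U"
proof (rule ccontr)
  assume *: "{x \<in> FIN. N \<le> Min x} \<notin> U"
  have "\<And>A. A \<subseteq> FIN \<Longrightarrow> A \<in> U \<or> FIN - A \<in> U"
    using assms by (simp add: block_generated_def ultrafilter_on_def)
  from this[of "{x \<in> FIN. N \<le> Min x}"] have "FIN - {x \<in> FIN. N \<le> Min x} \<in> U"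
    using * by auto
  then obtain X where X: "block_seq X" "block_span X \<subseteq> FIN - {x \<in> FIN. N \<le> Min x}"
    using assms unfolding block_generated_def by blast
  then have "\<not> N \<le> Min (X N)"
    using block_in_block_span[of X N] by blast
  then show False
    using block_seq_le_Min[OF X(1), of N] by simp
qed

text \<open>Intersect one witness for each \<open>t\<close> that has one; antimonotonicity carries
  every such \<open>R t\<close> down to the intersection.\<close>

lemma ultrafilter_on_decide_finitely_many:
  assumes "ultrafilter_on S U" "finite T"
    and antimono: "\<And>t A B. R t A \<Longrightarrow> B \<subseteq> A \<Longrightarrow> R t B"
  shows "\<exists>B\<in>U. \<forall>t\<in>T. (\<exists>A\<in>U. R t A) \<longrightarrow> R t B"
  using \<open>finite T\<close>
proof (induction T rule: finite_induct)
  case empty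
  then show ?case
    using assms(1) by (auto simp: ultrafilter_on_def)
next
  case (insert t T)
  then obtain B where B: "B \<in> U" "\<forall>t\<in>T. (\<exists>A\<in>U. R t A) \<longrightarrow> R t B"
    by blast
  have inter: "A \<inter> B \<in> U" if "A \<in> U" for A
    using assms(1) B(1) that by (simp add: ultrafilter_on_def)
  show ?case
  proof (cases "\<exists>A\<in>U. R t A")
    case True
    then obtain A where "A \<in> U" "R t A"
      by blast
    then have "\<forall>t'\<in>insert t T. (\<exists>A\<in>U. R t' A) \<longrightarrow> R t' (A \<inter> B)"
      using B(2) antimono by (metis Int_lower1 Int_lower2 insert_iff)
    then show ?thesis
      using inter[OF \<open>A \<in> U\<close>] by blast
  next
    case False
    then show ?thesis
      using B by blast
  qed
qed

lemma tukey_ge_monotone_map: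
  assumes "tukey_ge W V" "ultrafilter_on I V"
  obtains h where "mono h" "h ` W \<subseteq> V" "cofinal_in V (h ` W)"
proof -
  obtain g where g: "g ` W \<subseteq> V" and cof: "\<And>C. cofinal_in W C \<Longrightarrow> cofinal_in V (g ` C)"
    using assms(1) by (auto simp: tukey_ge_def)
  have V: "V \<subseteq> Pow I" "\<And>A B. A \<in> V \<Longrightarrow> B \<subseteq> I \<Longrightarrow> A \<subseteq> B \<Longrightarrow> B \<in> V"
    using assms(2) by (auto simp: ultrafilter_on_def)
  \<comment> \<open>The union over all members of \<open>W\<close> inside \<open>A\<close> makes
    \<open>h\<close> monotone on arbitrary sets; for \<open>A\<close> in \<open>W\<close> it
    contains \<open>g A\<close>, hence lies in \<open>V\<close>.\<close>
  define h where "h A = \<Union> (g ` {A' \<in> W. A' \<subseteq> A})" for A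
  have "mono h"
    by (auto simp: mono_def h_def)
  moreover have hW: "h ` W \<subseteq> V"
  proof clarify
    fix A
    assume A: "A \<in> W"
    show "h A \<in> V"
    proof (rule V(2))
      show "g A \<in> V"
        using g A by blast
      show "h A \<subseteq> I"
        using g V(1) by (auto simp: h_def)
      show "g A \<subseteq> h A"
        using A by (auto simp: h_def)
    qed
  qed
  moreover have "cofinal_in V (h ` W)"
    unfolding cofinal_in_def
  proof (intro conjI ballI hW)
    fix v
    assume v: "v \<in> V"
    \<comment> \<open>Otherwise the \<open>w'\<close> with \<open>g w'\<close> not inside
      \<open>v\<close> would be cofinal, and so would their images, one of which would then lie
      inside \<open>v\<close>.\<close>
    have "\<exists>w\<in>W. \<forall>w'\<in>W. w' \<subseteq> w \<longrightarrow> g w' \<subseteq> v"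
    proof (rule ccontr)
      assume "\<not> ?thesis"
      then have "cofinal_in W {w' \<in> W. \<not> g w' \<subseteq> v}"
        unfolding cofinal_in_def by blast
      from cof[OF this] show False
        using v by (auto simp: cofinal_in_def)
    qed
    then obtain w where "w \<in> W" "\<And>w'. w' \<in> W \<Longrightarrow> w' \<subseteq> w \<Longrightarrow> g w' \<subseteq> v"
      by blast
    then show "\<exists>B\<in>h ` W. B \<subseteq> v"
      by (intro bexI[of _ "h w"] imageI) (auto simp: h_def)
  qed
  ultimately show ?thesis
    by (rule that)
qed

section \<open>Traces and their prolongations\<close>

text \<open>Not determined by \<open>low_square N A\<close>: a block that starts below
  \<open>N\<close> and ends at \<open>N\<close> or beyond yields a low minimum, but its pair lies
  outside the square.\<close>

definition low_mins :: "nat \<Rightarrow> (nat \<times> nat) set \<Rightarrow> nat set" where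
  "low_mins N A = {m. m < N \<and> m \<in> fst ` A}"

definition low_square :: "nat \<Rightarrow> (nat \<times> nat) set \<Rightarrow> (nat \<times> nat) set" where
  "low_square N A = A \<inter> {..<N} \<times> {..<N}"

text \<open>The factor \<open>P \<times> Max ` B\<close> accounts for blocks that straddle the cut.\<close>

definition prolong :: "nat set \<Rightarrow> (nat \<times> nat) set \<Rightarrow> nat set set \<Rightarrow> (nat \<times> nat) set" where
  "prolong P Q B = Q \<union> P \<times> Max ` B \<union> minmax B"

lemma prolong_mono:
  "P \<subseteq> P' \<Longrightarrow> Q \<subseteq> Q' \<Longrightarrow> B \<subseteq> B' \<Longrightarrow> prolong P Q B \<subseteq> prolong P' Q' B'"
  unfolding prolong_def minmax_def by blast

text \<open>For the mixed pairs, \<open>m < N \<le> Min x \<le> Max x\<close> allows an exchange.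
  Under a monotone \<open>h\<close>, the tail therefore witnesses the omission of every
  \<open>i\<close> outside \<open>h A\<close>.\<close>

lemma prolong_tail_subset:
  assumes X: "block_seq X"
  defines "A \<equiv> minmax (block_span X)"
  shows "prolong (low_mins N A) (low_square N A) {x \<in> block_span X. N \<le> Min x} \<subseteq> A"
proof -
  have "(m, Max x) \<in> A" if m: "m \<in> low_mins N A" and x: "x \<in> block_span X" and Nx: "N \<le> Min x" for m x
  proof -
    obtain M where "(m, M) \<in> A" "m < N"
      using m by (auto simp: low_mins_def)
    moreover have "(Min x, Max x) \<in> A"
      using x by (auto simp: A_def minmax_def)
    moreover have "Min x \<le> Max x"
      using x block_span_subset_FIN[OF X] by (auto intro: Min_le_Max_FIN)
    ultimately show ?thesis
      using minmax_block_span_exchange[OF X, of m M "Min x" "Max x"] Nx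
      by (simp add: A_def)
  qed
  then show ?thesis
    unfolding prolong_def low_square_def by (auto simp: A_def minmax_def)
qed

definition block_splice :: "(nat \<Rightarrow> nat set) \<Rightarrow> nat \<Rightarrow> (nat \<Rightarrow> nat set) \<Rightarrow> nat \<Rightarrow> nat set" where
  "block_splice X n Y j = (if j \<le> n then X j else Y (j - Suc n))"

lemma block_seq_block_splice:
  assumes "block_seq X" "block_seq Y" "Max (X n) < Min (Y 0)"
  shows "block_seq (block_splice X n Y)"
proof -
  have "Max (block_splice X n Y j) < Min (block_splice X n Y (Suc j))" for j
  proof (cases j n rule: linorder_cases)
    case greater
    then have "Suc j - Suc n = Suc (j - Suc n)"
      by simp
    then show ?thesis
      using greater assms(2) by (simp add: block_splice_def block_seq_def del: diff_Suc_Suc)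
  qed (use assms in \<open>auto simp: block_splice_def block_seq_def\<close>)
  then show ?thesis
    using assms by (auto simp: block_seq_def block_splice_def)
qed

lemma block_span_subset_block_splice: "block_span Y \<subseteq> block_span (block_splice X n Y)"
  using block_span_shift[of "block_splice X n Y" "Suc n"] by (simp add: block_splice_def)

text \<open>\<open>N\<close> is one past the last block kept from \<open>X\<close>. A pair with
  indices \<open>p \<le> q\<close> is a square pair, a mixed pair or a pair of \<open>Y\<close>
  according to where the cut after index \<open>n\<close> falls; a pair in \<open>A\<close> itself
  supplies the entry of the trace that it needs.\<close>

lemma subset_prolong_block_splice:
  assumes X: "block_seq X" and Y: "block_seq Y" and XY: "Max (X n) < Min (Y 0)"
    and A: "A \<subseteq> minmax (block_span (block_splice X n Y))" and N: "N = Suc (Max (X n))"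
  shows "A \<subseteq> prolong (low_mins N A) (low_square N A) (block_span Y)"
proof
  fix c
  assume c: "c \<in> A"
  then obtain p q where pq: "p \<le> q" and c_eq: "c = (Min (block_splice X n Y p), Max (block_splice X n Y q))"
    using A by (auto simp: minmax_block_span[OF block_seq_block_splice[OF X Y XY]])
  have low: "Min (X j) < N" "Max (X j) < N" if "j \<le> n" for j
    using block_seq_Max_mono[OF X that] Min_le_Max_FIN[OF FIN_block[OF X], of j] N by auto
  consider "q \<le> n" | "p \<le> n" "n < q" | "n < p"
    by linarith
  then show "c \<in> prolong (low_mins N A) (low_square N A) (block_span Y)"
  proof cases
    case 1
    then have "c \<in> low_square N A"
      using c pq low by (auto simp: low_square_def c_eq block_splice_def)
    then show ?thesis
      by (simp add: prolong_def)
  next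
    case 2
    then have "fst c \<in> low_mins N A"
      using imageI[OF c, of fst] low by (auto simp: low_mins_def c_eq block_splice_def)
    moreover have "snd c \<in> Max ` block_span Y"
      using 2 block_in_block_span[of Y] by (auto simp: c_eq block_splice_def)
    ultimately show ?thesis
      by (cases c) (simp add: prolong_def)
  next
    case 3
    then have "c = (Min (Y (p - Suc n)), Max (Y (q - Suc n)))" "p - Suc n \<le> q - Suc n"
      using pq by (auto simp: c_eq block_splice_def)
    then have "c \<in> minmax (block_span Y)"
      unfolding minmax_block_span[OF Y] by blast
    then show ?thesis
      by (simp add: prolong_def)
  qed
qed

text \<open>The square in which \<open>A\<close> has to be known depends on \<open>A\<close>: it must contain a pair
  coming from a block beyond \<open>N\<close>.\<close>

lemma trace_locally_constant:
  assumes X: "block_seq X" and A: "A = minmax (block_span X)"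
  shows "\<exists>K. \<forall>Y. block_seq Y \<longrightarrow> low_square K (minmax (block_span Y)) = low_square K A \<longrightarrow>
    low_mins N (minmax (block_span Y)) = low_mins N A \<and>
    low_square N (minmax (block_span Y)) = low_square N A"
proof -
  \<comment> \<open>Block \<open>N\<close> starts at \<open>N\<close> or later, so every low minimum
    can be combined with \<open>M\<close>.\<close>
  define m M where "m = Min (X N)" and "M = Max (X N)"
  have mM: "N \<le> m" "m \<le> M" "(m, M) \<in> A"
    using block_seq_le_Min[OF X, of N] Min_le_Max_FIN[OF FIN_block[OF X], of N]
    by (auto simp: m_def M_def A minmax_block_span[OF X])
  \<comment> \<open>The least bound whose square contains \<open>(m, M)\<close>.\<close>
  define K where "K = Suc M"
  \<comment> \<open>Equality of the squares puts \<open>(m, M)\<close> into the other set too. By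
    exchange, \<open>k < N\<close> is then a minimum exactly when \<open>(k, M)\<close> is present,
    which the square shows.\<close>
  have low_mins: "low_mins N (minmax (block_span Y)) = {k. k < N \<and> (k, M) \<in> low_square K A}"
    if Y: "block_seq Y" and eq: "low_square K (minmax (block_span Y)) = low_square K A" for Y
  proof -
    have "(m, M) \<in> low_square K A"
      using mM by (auto simp: low_square_def K_def)
    then have "(m, M) \<in> minmax (block_span Y)"
      unfolding eq[symmetric] by (simp add: low_square_def)
    then have "(k, M) \<in> minmax (block_span Y)" if "k < N" "(k, l) \<in> minmax (block_span Y)" for k l
      using minmax_block_span_exchange[OF Y that(2), of m M] that(1) mM by simp
    then have "k \<in> fst ` minmax (block_span Y) \<longleftrightarrow> (k, M) \<in> minmax (block_span Y)" if "k < N" for k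
      using that by (auto intro: image_eqI[of _ fst "(k, M)"])
    then show ?thesis
      using mM unfolding eq[symmetric] by (auto simp: low_mins_def low_square_def K_def)
  qed
  have sq: "low_square N B = low_square N (low_square K B)" for B
    using mM by (auto simp: low_square_def K_def)
  show ?thesis
  proof (rule exI[of _ K], intro allI impI conjI)
    fix Y
    assume Y: "block_seq Y" "low_square K (minmax (block_span Y)) = low_square K A"
    show "low_mins N (minmax (block_span Y)) = low_mins N A"
      using low_mins[OF Y] low_mins[OF X] by (simp add: A)
    show "low_square N (minmax (block_span Y)) = low_square N A"
      using Y(2) sq[of A] sq[of "minmax (block_span Y)"] by simp
  qed
qed

section \<open>Continuity for the Cantor topologies\<close>

lemma openin_cantor_topology_coordinate:
  assumes "i \<in> S"
  shows "openin (cantor_topology S) {A \<in> Pow S. (i \<in> A) = b}"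
proof -
  let ?P = "product_topology (\<lambda>_. discrete_topology (UNIV :: bool set)) S"
  have "openin ?P {x \<in> topspace ?P. x i \<in> {b}}"
    by (rule openin_continuous_map_preimage[OF continuous_map_product_projection[OF assms]]) simp
  moreover have "{A \<in> Pow S. (i \<in> A) = b} =
      (\<lambda>A. \<lambda>i\<in>S. i \<in> A) -` {x \<in> topspace ?P. x i \<in> {b}} \<inter> Pow S"
    using assms by auto
  ultimately show ?thesis
    unfolding cantor_topology_def openin_pullback_topology by blast
qed

lemma continuous_map_into_cantor_topology:
  assumes "f ` topspace T \<subseteq> Pow S"
    and "\<And>i b. i \<in> S \<Longrightarrow> openin T {x \<in> topspace T. (i \<in> f x) = b}"
  shows "continuous_map T (cantor_topology S) f"
  unfolding cantor_topology_def
proof (rule continuous_map_pullback')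
  show "continuous_map T (product_topology (\<lambda>_. discrete_topology UNIV) S)
    ((\<lambda>A. \<lambda>i\<in>S. i \<in> A) \<circ> f)"
    unfolding continuous_map_componentwise
  proof (intro conjI ballI)
    fix i
    assume i: "i \<in> S"
    have "openin T {x \<in> topspace T. (i \<in> f x) \<in> B}" for B
    proof -
      have "{x \<in> topspace T. (i \<in> f x) \<in> B} = (\<Union>b\<in>B. {x \<in> topspace T. (i \<in> f x) = b})"
        by auto
      then show ?thesis
        using assms(2)[OF i] by auto
    qed
    then show "continuous_map T (discrete_topology UNIV) (\<lambda>x. ((\<lambda>A. \<lambda>i\<in>S. i \<in> A) \<circ> f) x i)"
      using i by (simp add: continuous_map_def)
  qed auto
qed (use assms(1) in auto)

lemma openin_low_square_eq:
  "openin (cantor_topology UNIV) {A'. low_square K A' = low_square K A}"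
\<comment> \<open>For \<open>K = 0\<close> the condition is vacuous, and the intersection used
  otherwise would have an empty index set, which \<open>openin_INT2\<close> excludes.\<close>
proof (cases "K = 0")
  case True
  then show ?thesis
    using openin_topspace[of "cantor_topology (UNIV :: (nat \<times> nat) set)"] by (simp add: low_square_def)
next
  case False
  have "{A'. low_square K A' = low_square K A} =
      (\<Inter>c\<in>{..<K} \<times> {..<K}. {A' \<in> Pow UNIV. (c \<in> A') = (c \<in> A)})"
    by (auto simp: low_square_def)
  moreover have "openin (cantor_topology UNIV)
      (\<Inter>c\<in>{..<K} \<times> {..<K}. {A' \<in> Pow UNIV. (c \<in> A') = (c \<in> A)})"
    using False by (intro openin_INT2 openin_cantor_topology_coordinate) auto
  ultimately show ?thesis
    by simp
qed

text \<open>Each point of \<open>D\<close> has a relatively open neighbourhood on which the trace is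
  constant. Staying inside \<open>D\<close> matters: for arbitrary \<open>A\<close> and
  \<open>m < N\<close>, the condition \<open>m \<in> low_mins N A\<close> is open but not
  closed.\<close>

lemma openin_subtopology_trace_invariant:
  assumes D: "D \<subseteq> {minmax (block_span X) | X. block_seq X}"
    and R: "\<And>A B. low_mins N A = low_mins N B \<Longrightarrow> low_square N A = low_square N B \<Longrightarrow> R A \<Longrightarrow> R B"
  shows "openin (subtopology (cantor_topology UNIV) D) {A \<in> D. R A}"
proof (subst openin_subopen, intro ballI)
  fix A
  assume A: "A \<in> {A \<in> D. R A}"
  then obtain X where "block_seq X" "A = minmax (block_span X)"
    using D by blast
  from trace_locally_constant[OF this, of N] obtain K where K:
    "\<And>Y. block_seq Y \<Longrightarrow> low_square K (minmax (block_span Y)) = low_square K A \<Longrightarrow>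
      low_mins N (minmax (block_span Y)) = low_mins N A \<and>
      low_square N (minmax (block_span Y)) = low_square N A"
    by blast
  let ?O = "D \<inter> {A'. low_square K A' = low_square K A}"
  have "openin (subtopology (cantor_topology UNIV) D) ?O"
    by (rule openin_subtopology_Int2[OF openin_low_square_eq])
  moreover have "R A'" if "A' \<in> ?O" for A'
  proof -
    obtain Y where "block_seq Y" "A' = minmax (block_span Y)"
      using \<open>A' \<in> ?O\<close> D by blast
    then have "low_mins N A = low_mins N A'" "low_square N A = low_square N A'"
      using K[of Y] \<open>A' \<in> ?O\<close> by auto
    then show ?thesis
      using R A by blast
  qed
  ultimately show "\<exists>T. openin (subtopology (cantor_topology UNIV) D) T \<and> A \<in> T \<and> T \<subseteq> {A \<in> D. R A}"
    using A by (intro exI[of _ ?O]) auto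
qed

section \<open>Canonical cofinal maps\<close>

theorem theorem72:
  fixes U :: "nat set set set" and I :: "'i set" and V :: "'i set set"
  assumes "block_basic U"
    and "countable I"
    and "ultrafilter_on I V"
    and "tukey_ge (minmax_ultrafilter U) V"
  shows "\<exists>X\<^sub>0 (f :: (nat \<times> nat) set \<Rightarrow> 'i set).
    block_seq X\<^sub>0 \<and> block_span X\<^sub>0 \<in> U \<and>
    (let D = {minmax (block_span X) | X. block_seq X \<and> block_le X X\<^sub>0};
         D\<^sub>U = {minmax (block_span X) | X. block_seq X \<and> block_le X X\<^sub>0 \<and> block_span X \<in> U}
     in f ` D \<subseteq> Pow I \<and>
        mono_on D f \<and>
        continuous_map (subtopology (cantor_topology UNIV) D) (cantor_topology I) f \<and>
        f ` D\<^sub>U \<subseteq> V \<and> cofinal_in V (f ` D\<^sub>U))"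
proof -
  obtain h where h: "mono h" "h ` minmax_ultrafilter U \<subseteq> V" "cofinal_in V (h ` minmax_ultrafilter U)"
    using tukey_ge_monotone_map[OF assms(4,3)] .
  have gen: "block_generated U"
    using assms(1) by (simp add: block_basic_def)
  then have ultra: "ultrafilter_on FIN U"
    by (simp add: block_generated_def)
  then have U: "FIN \<in> U" "\<And>A B. A \<in> U \<Longrightarrow> B \<in> U \<Longrightarrow> A \<inter> B \<in> U"
      "\<And>A B. A \<in> U \<Longrightarrow> B \<subseteq> FIN \<Longrightarrow> A \<subseteq> B \<Longrightarrow> B \<in> U"
    by (auto simp: ultrafilter_on_def)
  have base: "\<exists>X. block_seq X \<and> block_span X \<in> U \<and> block_span X \<subseteq> A" if "A \<in> U" for A
    using gen that by (simp add: block_generated_def)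
  have VI: "V \<subseteq> Pow I"
    using assms(3) by (simp add: ultrafilter_on_def)
  obtain X where X: "block_seq X" "block_span X \<in> U"
    using base[OF U(1)] by blast
  define N where "N n = Suc (Max (X n))" for n
  let ?idx = "to_nat_on I"

  have "\<exists>Y. block_seq Y \<and> block_span Y \<in> U \<and> N n \<le> Min (Y 0) \<and>
      (\<forall>i P Q. i \<in> I \<longrightarrow> ?idx i \<le> n \<longrightarrow> P \<subseteq> {..<N n} \<longrightarrow> Q \<subseteq> {..<N n} \<times> {..<N n} \<longrightarrow>
        (\<exists>B\<in>U. i \<notin> h (prolong P Q B)) \<longrightarrow> i \<notin> h (prolong P Q (block_span Y)))" for n
  proof -
    let ?T = "{i \<in> I. ?idx i \<le> n} \<times> Pow {..<N n} \<times> Pow ({..<N n} \<times> {..<N n})"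
    let ?R = "\<lambda>(i, P, Q) B. i \<notin> h (prolong P Q B)"
    \<comment> \<open>Injectivity of the enumeration on the countable \<open>I\<close> leaves
      finitely many \<open>i\<close>, so the demands on \<open>Y\<close> are finite in
      number.\<close>
    have "finite {i \<in> I. ?idx i \<le> n}"
      by (rule finite_imageD[of ?idx])
        (auto intro: finite_subset[of _ "{..n}"] inj_on_subset[OF inj_on_to_nat_on[OF assms(2)]])
    then have T: "finite ?T"
      by simp
    have antimono: "?R t B" if "?R t A" "B \<subseteq> A" for t A B
      using that monoD[OF h(1) prolong_mono[OF subset_refl subset_refl that(2)]]
      by (cases t) auto
    have "\<exists>B\<in>U. \<forall>t\<in>?T. (\<exists>A\<in>U. ?R t A) \<longrightarrow> ?R t B"
      by (rule ultrafilter_on_decide_finitely_many[OF ultra T]) (fact antimono)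
    then obtain B where B: "B \<in> U" "\<forall>t\<in>?T. (\<exists>A\<in>U. ?R t A) \<longrightarrow> ?R t B"
      by blast
    \<comment> \<open>The tail makes \<open>Y\<close> start after \<open>X n\<close>, ready for
      splicing; shrinking \<open>B\<close> keeps all omissions because \<open>h\<close> is
      monotone.\<close>
    obtain Y where Y: "block_seq Y" "block_span Y \<in> U"
        "block_span Y \<subseteq> B \<inter> {x \<in> FIN. N n \<le> Min x}"
      using base[OF U(2)[OF B(1) ultrafilter_on_tail[OF gen]]] by blast
    have "i \<notin> h (prolong P Q (block_span Y))"
      if "i \<in> I" "?idx i \<le> n" "P \<subseteq> {..<N n}" "Q \<subseteq> {..<N n} \<times> {..<N n}"
        "\<exists>B\<in>U. i \<notin> h (prolong P Q B)" for i P Q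
    proof -
      have "i \<notin> h (prolong P Q B)"
        using that B(2) by blast
      moreover have "h (prolong P Q (block_span Y)) \<subseteq> h (prolong P Q B)"
        using Y(3) by (intro monoD[OF h(1)] prolong_mono) auto
      ultimately show ?thesis
        by blast
    qed
    moreover have "N n \<le> Min (Y 0)"
      using Y(3) block_in_block_span[of Y 0] by blast
    ultimately show ?thesis
      using Y(1,2) by blast
  qed
  then obtain Y where Y: "\<And>n. block_seq (Y n)" "\<And>n. block_span (Y n) \<in> U"
      "\<And>n. N n \<le> Min (Y n 0)"
    and omit: "\<And>n i P Q B. i \<in> I \<Longrightarrow> ?idx i \<le> n \<Longrightarrow> P \<subseteq> {..<N n} \<Longrightarrow>
      Q \<subseteq> {..<N n} \<times> {..<N n} \<Longrightarrow> B \<in> U \<Longrightarrow> i \<notin> h (prolong P Q B) \<Longrightarrow>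
      i \<notin> h (prolong P Q (block_span (Y n)))"
    by metis

  define Z where "Z n = block_splice X n (Y n)" for n
  have XY: "Max (X n) < Min (Y n 0)" for n
    using Y(3)[of n] by (simp add: N_def)
  have Z: "block_seq (Z n)" "block_span (Z n) \<in> U" for n
  proof -
    show *: "block_seq (Z n)"
      using block_seq_block_splice[OF X(1) Y(1) XY] by (simp add: Z_def)
    show "block_span (Z n) \<in> U"
      using U(3)[OF Y(2)[of n] block_span_subset_FIN[OF *]] block_span_subset_block_splice by (simp add: Z_def)
  qed
  have "block_converges Z X"
    unfolding block_converges_def
  proof
    show "\<exists>m. \<forall>n\<ge>m. \<forall>k\<le>l. Z n k = X k" for l
      by (rule exI[of _ l]) (simp add: Z_def block_splice_def)
  qed
  then obtain r :: "nat \<Rightarrow> nat" where r: "strict_mono r" "(\<Inter>k. block_span (Z (r k))) \<in> U"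
    using assms(1) X Z unfolding block_basic_def by blast
  obtain X\<^sub>0 where X0: "block_seq X\<^sub>0" "block_span X\<^sub>0 \<in> U" "block_span X\<^sub>0 \<subseteq> (\<Inter>k. block_span (Z (r k)))"
    using base[OF r(2)] by blast

  define D where "D = {minmax (block_span X) | X. block_seq X \<and> block_le X X\<^sub>0}"
  define D\<^sub>U where "D\<^sub>U = {minmax (block_span X) | X. block_seq X \<and> block_le X X\<^sub>0 \<and> block_span X \<in> U}"
  \<comment> \<open>An index of the subsequence, so that \<open>block_span X\<^sub>0\<close> lies in
    \<open>block_span (Z (n i))\<close>; and \<open>?idx i \<le> r (?idx i)\<close> makes
    \<open>omit\<close> available for \<open>i\<close> at stage \<open>n i\<close>.\<close>
  define n where "n i = r (?idx i)" for i
  \<comment> \<open>With \<open>Y (n i)\<close> fixed, \<open>E i A\<close> depends only on the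
    trace of \<open>A\<close> at \<open>N (n i)\<close> and grows with it: the source of continuity
    and monotonicity of \<open>f\<close>.\<close>
  define E where "E i A = prolong (low_mins (N (n i)) A) (low_square (N (n i)) A) (block_span (Y (n i)))"
    for i A
  define f where "f A = {i \<in> I. i \<in> h (E i A)}" for A

  have subset_E: "A \<subseteq> E i A" if "A \<in> D" for A i
  proof -
    obtain W where "A = minmax (block_span W)" "block_le W X\<^sub>0"
      using \<open>A \<in> D\<close> by (auto simp: D_def)
    then have "A \<subseteq> minmax (block_span (Z (n i)))"
      using block_span_mono[of W X\<^sub>0] X0(3) unfolding n_def by (auto intro!: minmax_mono)
    then show ?thesis
      unfolding E_def Z_def by (intro subset_prolong_block_splice[OF X(1) Y(1) XY]) (auto simp: N_def)
  qed
  have DU_D: "D\<^sub>U \<subseteq> D"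
    by (auto simp: D_def D\<^sub>U_def)
  have DU_minmax: "D\<^sub>U \<subseteq> minmax_ultrafilter U"
    by (auto simp: D\<^sub>U_def minmax_ultrafilter_def)
  \<comment> \<open>One inclusion is \<open>subset_E\<close>. For the other, a tail of
    \<open>W\<close> prolongs the trace within \<open>A\<close>, and \<open>omit\<close> transfers
    the omission of \<open>i\<close> from that tail to \<open>Y (n i)\<close>.\<close>
  have f_eq: "f A = h A" if A: "A \<in> D\<^sub>U" for A
  proof -
    have "h A \<subseteq> I"
      using A DU_minmax h(2) VI by blast
    moreover have "i \<in> h (E i A)" if "i \<in> h A" for i
      using monoD[OF h(1) subset_E] A DU_D that by blast
    moreover have "i \<notin> h (E i A)" if "i \<in> I" "i \<notin> h A" for i
    proof -
      obtain W where W: "block_seq W" "block_span W \<in> U" and A_eq: "A = minmax (block_span W)"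
        using A by (auto simp: D\<^sub>U_def)
      let ?B = "{x \<in> block_span W. N (n i) \<le> Min x}"
      have "?B = block_span W \<inter> {x \<in> FIN. N (n i) \<le> Min x}"
        using block_span_subset_FIN[OF W(1)] by blast
      then have "?B \<in> U"
        using U(2)[OF W(2) ultrafilter_on_tail[OF gen]] by simp
      moreover have "i \<notin> h (prolong (low_mins (N (n i)) A) (low_square (N (n i)) A) ?B)"
        using monoD[OF h(1) prolong_tail_subset[OF W(1), of "N (n i)"]] that(2)
        unfolding A_eq by blast
      ultimately show ?thesis
        unfolding E_def using that(1) strict_mono_imp_increasing[OF r(1), of "?idx i"]
        by (intro omit) (auto simp: n_def low_mins_def low_square_def)
    qed
    ultimately show ?thesis
      by (auto simp: f_def)
  qed
  have "mono_on D f"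
  proof (rule mono_onI)
    fix A B :: "(nat \<times> nat) set"
    assume "A \<subseteq> B"
    then have "E i A \<subseteq> E i B" for i
      unfolding E_def by (intro prolong_mono) (auto simp: low_mins_def low_square_def)
    then have "h (E i A) \<subseteq> h (E i B)" for i
      by (intro monoD[OF h(1)])
    then show "f A \<subseteq> f B"
      unfolding f_def by blast
  qed
  moreover have "continuous_map (subtopology (cantor_topology UNIV) D) (cantor_topology I) f"
  proof (rule continuous_map_into_cantor_topology)
    fix i b
    have "openin (subtopology (cantor_topology UNIV) D) {A \<in> D. (i \<in> f A) = b}"
      by (rule openin_subtopology_trace_invariant[where N = "N (n i)"])
        (auto simp: D_def f_def E_def)
    then show "openin (subtopology (cantor_topology UNIV) D)
        {A \<in> topspace (subtopology (cantor_topology UNIV) D). (i \<in> f A) = b}"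
      by simp
  qed (auto simp: f_def)
  moreover have fV: "f ` D\<^sub>U \<subseteq> V"
    using DU_minmax h(2) by (auto simp: f_eq image_subset_iff subset_iff)
  moreover have "cofinal_in V (f ` D\<^sub>U)"
    unfolding cofinal_in_def
  proof (intro conjI ballI fV)
    fix v
    assume "v \<in> V"
    then obtain B where B: "B \<in> minmax_ultrafilter U" "h B \<subseteq> v"
      using h(3) by (auto simp: cofinal_in_def)
    then obtain A where A: "A \<in> U" "minmax A \<subseteq> B"
      by (auto simp: minmax_ultrafilter_def)
    \<comment> \<open>Lying inside \<open>A\<close> makes the value of \<open>h\<close> small; lying
      below \<open>X\<^sub>0\<close> puts the set into \<open>D\<^sub>U\<close>, where
      \<open>f\<close> equals \<open>h\<close>.\<close>
    obtain W where W: "block_seq W" "block_span W \<in> U" "block_span W \<subseteq> A \<inter> block_span X\<^sub>0"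
      using base[OF U(2)[OF A(1) X0(2)]] by blast
    have "minmax (block_span W) \<in> D\<^sub>U"
      using W block_le_if_span_subset[of W X\<^sub>0] by (auto simp: D\<^sub>U_def)
    moreover have "h (minmax (block_span W)) \<subseteq> v"
      using monoD[OF h(1), of "minmax (block_span W)" B] minmax_mono[of "block_span W" A] W(3) A(2) B(2)
      by blast
    ultimately show "\<exists>B\<in>f ` D\<^sub>U. B \<subseteq> v"
      using f_eq by auto
  qed
  moreover have "f ` D \<subseteq> Pow I"
    by (auto simp: f_def)
  ultimately have "f ` D \<subseteq> Pow I \<and> mono_on D f \<and>
      continuous_map (subtopology (cantor_topology UNIV) D) (cantor_topology I) f \<and>
      f ` D\<^sub>U \<subseteq> V \<and> cofinal_in V (f ` D\<^sub>U)"
    by blast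
  then show ?thesis
    unfolding Let_def D_def D\<^sub>U_def by (intro exI[of _ X\<^sub>0] exI[of _ f] conjI[OF X0(1)] conjI[OF X0(2)])
qed

end
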